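(* Let $P_3$ denote the path with $3$ edges (and $4$ vertices). Then $g(n,P_3)=n^{o(1)}$ as $n\to\infty$.
   Context: For a positive integer $n$ and a graph $H$: for each vertex $v$ of the complete graph $K_n$ let $f_v$ be a (not necessarily proper) colouring of the edges of the same $K_n$. The collection $\{f_v\}$ is called $(n,H)$-local if for every copy $T$ of $H$ in $K_n$ (i.e. every subgraph of $K_n$ isomorphic to $H$), there exists a vertex $u\in V(T)$ such that all edges of $T$ receive pairwise different colours in $f_u$. $g(n,H)$ is the smallest $k$ for which there is an $(n,H)$-local collection of colourings each using at most $k$ colours. *)

theory Defs
  imports Complex_Main "HOL-Library.Landau_Symbols"
begin

text \<open>A simple undirected graph is a pair of a vertex set and a set of two-element sets of
  vertices.\<close>

type_synonym 'a sgraph = "'a set \<times> 'a set set"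

abbreviation vertices :: "'a sgraph \<Rightarrow> 'a set" where
  "vertices G \<equiv> fst G"

abbreviation edges :: "'a sgraph \<Rightarrow> 'a set set" where
  "edges G \<equiv> snd G"

definition simple_graph :: "'a sgraph \<Rightarrow> bool" where
  "simple_graph G \<longleftrightarrow> edges G \<subseteq> {e. e \<subseteq> vertices G \<and> card e = 2}"

definition is_subgraph :: "'a sgraph \<Rightarrow> 'a sgraph \<Rightarrow> bool" where
  "is_subgraph T G \<longleftrightarrow> simple_graph T \<and> vertices T \<subseteq> vertices G \<and> edges T \<subseteq> edges G"

definition isomorphic :: "'a sgraph \<Rightarrow> 'b sgraph \<Rightarrow> bool" where
  "isomorphic G H \<longleftrightarrow>
     (\<exists>\<phi>. bij_betw \<phi> (vertices G) (vertices H) \<and>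
          (\<forall>u\<in>vertices G. \<forall>v\<in>vertices G. {u, v} \<in> edges G \<longleftrightarrow> {\<phi> u, \<phi> v} \<in> edges H))"

definition complete_graph :: "nat \<Rightarrow> nat sgraph" where
  "complete_graph n = ({..<n}, {e. e \<subseteq> {..<n} \<and> card e = 2})"

text \<open>The index is the number of edges: there are \<open>m + 1\<close> vertices \<open>0, \<dots>, m\<close>.\<close>

definition path_graph :: "nat \<Rightarrow> nat sgraph" where
  "path_graph m = ({..m}, {{i, Suc i} | i. i < m})"

text \<open>Copies need not be induced.\<close>

definition copies :: "nat \<Rightarrow> 'a sgraph \<Rightarrow> nat sgraph set" where
  "copies n H = {T. is_subgraph T (complete_graph n) \<and> isomorphic T H}"

text \<open>Colours are natural numbers, which loses nothing as \<open>K\<^sub>n\<close> has finitely many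
  edges. The values \<open>f v e\<close> are only relevant for vertices \<open>v\<close> and edges \<open>e\<close> of \<open>K\<^sub>n\<close>.\<close>

definition local_collection :: "nat \<Rightarrow> 'a sgraph \<Rightarrow> (nat \<Rightarrow> nat set \<Rightarrow> nat) \<Rightarrow> bool" where
  "local_collection n H f \<longleftrightarrow> (\<forall>T\<in>copies n H. \<exists>u\<in>vertices T. inj_on (f u) (edges T))"

definition uses_at_most :: "nat \<Rightarrow> (nat \<Rightarrow> nat set \<Rightarrow> nat) \<Rightarrow> nat \<Rightarrow> bool" where
  "uses_at_most n f k \<longleftrightarrow>
     (\<forall>v\<in>vertices (complete_graph n). card (f v ` edges (complete_graph n)) \<le> k)"

definition g :: "nat \<Rightarrow> 'a sgraph \<Rightarrow> nat" where
  "g n H = (LEAST k. \<exists>f. local_collection n H f \<and> uses_at_most n f k)"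

text \<open>The minimum in \<open>g\<close> is attained as soon as \<open>H\<close> has a vertex, since giving all edges
  different colours works.\<close>

lemma g_attained:
  assumes "vertices H \<noteq> {}"
  shows "\<exists>f. local_collection n H f \<and> uses_at_most n f (g n H)"
proof -
  let ?E = "edges (complete_graph n)"
  have "finite ?E" unfolding complete_graph_def by simp
  then obtain c :: "nat set \<Rightarrow> nat" where c: "inj_on c ?E"
    using finite_imp_inj_to_nat_seg by blast
  have "local_collection n H (\<lambda>_. c)"
    unfolding local_collection_def
  proof
    fix T assume "T \<in> copies n H"
    then have T: "edges T \<subseteq> ?E" "isomorphic T H"
      unfolding copies_def is_subgraph_def by auto
    from T(2) assms have "vertices T \<noteq> {}"
      unfolding isomorphic_def bij_betw_def by auto
    moreover have "inj_on c (edges T)" using c T(1) by (rule inj_on_subset)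
    ultimately show "\<exists>u\<in>vertices T. inj_on c (edges T)" by blast
  qed
  moreover have "uses_at_most n (\<lambda>_. c) (card (c ` ?E))"
    unfolding uses_at_most_def by simp
  ultimately have "\<exists>k f. local_collection n H f \<and> uses_at_most n f k" by blast
  then show ?thesis unfolding g_def by (rule LeastI_ex)
qed

end

(* Write vertices in binary. Giving the edges at u the colour of their highest differing digit
   deals with every path a b c d, through u = b or u = c, unless its three edges have the same
   highest differing digit; such a path lies in a bipartite graph, with a, c on one side and b, d
   on the other. It then suffices to find, for each pair a, c on one side, a partition P a c of the
   other side, and for each pair b, d there a partition Q b d of the first side, all into O(n^(1/r))
   classes, such that P a c separates b from d or Q b d separates a from c: then a or d works.

   Encode the vertices of the first side by words over an alphabet of size O(n^(1/r)), with places
   K = {0..h^2} and distinct words agreeing in at most h = r - 1 places, and those of the second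
   side by such words whose places are the subsets of K. Let P a c read the place E, the set of
   places where the words of a and c agree, and let Q b d read a place i of K outside the union of
   the at most h sets of size at most h at which the words of b and d agree. If neither separates,
   then E is one of these sets, so i is not in E, but a and c agree at i, so i is in E. *)

theory Submission
  imports Defs
begin

section \<open>Residue codes from pairwise coprime moduli\<close>

text \<open>A common divisor is prime to \<open>M\<close>, as it divides \<open>1 + i * M\<close>,
  and it divides the difference \<open>(j - i) * M\<close>; so it divides \<open>j - i\<close> and
  thus \<open>M\<close>.\<close>

lemma coprime_arith_progression:
  fixes M i j :: nat
  assumes "i < j" "(j - i) dvd M"
  shows "coprime (1 + i * M) (1 + j * M)"
proof (rule coprimeI)
  fix c assume c: "c dvd 1 + i * M" "c dvd 1 + j * M"
  have cop: "coprime c M"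
  proof (rule coprimeI)
    fix d assume "d dvd c" "d dvd M"
    then have "d dvd 1 + i * M" "d dvd i * M" using c(1) by (auto intro: dvd_trans)
    then show "is_unit d" using dvd_add_left_iff by blast
  qed
  have "c dvd (1 + j * M) - (1 + i * M)" using c by (intro dvd_diff_nat)
  also have "(1 + j * M) - (1 + i * M) = (j - i) * M" by (simp add: diff_mult_distrib)
  finally have "c dvd j - i" using cop coprime_dvd_mult_left_iff by blast
  then have "c dvd M" using assms(2) by (rule dvd_trans)
  then show "is_unit c" using cop by (simp add: coprime_absorb_left)
qed

text \<open>The moduli of Goedel's beta function, \<open>1 + k * (fact N * t)\<close> with
  \<open>1 \<le> k \<le> N\<close>, work: differences of the multipliers \<open>k\<close> divide
  \<open>fact N\<close>.\<close>

lemma ex_coprime_moduli: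
  assumes "finite I"
  shows "\<exists>C. \<forall>t\<ge>1. \<exists>q :: 'i \<Rightarrow> nat.
    (\<forall>i\<in>I. t < q i \<and> q i \<le> C * t) \<and> (\<forall>i\<in>I. \<forall>j\<in>I. i \<noteq> j \<longrightarrow> coprime (q i) (q j))"
proof -
  define N where "N = card I"
  obtain k where k: "bij_betw k I {..<N}"
    using assms N_def ex_bij_betw_finite_nat[of I] by (auto simp: atLeast0LessThan)
  show ?thesis
  proof (intro exI[of _ "1 + N * fact N"] allI impI)
    fix t :: nat assume t: "1 \<le> t"
    define q where "q i = 1 + Suc (k i) * (fact N * t)" for i
    have less: "k i < N" if "i \<in> I" for i using k that by (auto dest: bij_betwE)
    have "t < q i" "q i \<le> (1 + N * fact N) * t" if "i \<in> I" for i
    proof -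
      have "1 * t \<le> fact N * t" by (rule mult_right_mono) auto
      then show "t < q i" by (simp add: q_def less_Suc_eq_le trans_le_add1)
      have "Suc (k i) * (fact N * t) \<le> N * (fact N * t)"
        using less[OF that] by (intro mult_right_mono) auto
      then show "q i \<le> (1 + N * fact N) * t" using t by (simp add: q_def algebra_simps)
    qed
    moreover have "coprime (q i) (q j)" if "i \<in> I" "j \<in> I" "k i < k j" for i j
      unfolding q_def
    proof (rule coprime_arith_progression)
      have "(k j - k i) dvd (fact N :: nat)"
        using that less[of j] by (intro dvd_fact) auto
      then show "Suc (k j) - Suc (k i) dvd fact N * t" by simp
    qed (use that in auto)
    then have "coprime (q i) (q j)" if "i \<in> I" "j \<in> I" "i \<noteq> j" for i j
      using that bij_betw_imp_inj_on[OF k]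
      by (metis coprime_commute inj_onD linorder_neq_iff)
    ultimately show "\<exists>q. (\<forall>i\<in>I. t < q i \<and> q i \<le> (1 + N * fact N) * t) \<and>
        (\<forall>i\<in>I. \<forall>j\<in>I. i \<noteq> j \<longrightarrow> coprime (q i) (q j))"
      by blast
  qed
qed

lemma prod_coprime_dvd:
  fixes q :: "'i \<Rightarrow> nat"
  assumes "finite E" "\<And>i j. i \<in> E \<Longrightarrow> j \<in> E \<Longrightarrow> i \<noteq> j \<Longrightarrow> coprime (q i) (q j)"
    and "\<And>i. i \<in> E \<Longrightarrow> q i dvd z"
  shows "(\<Prod>i\<in>E. q i) dvd z"
  using assms
proof (induction E rule: finite_induct)
  case (insert i E)
  have "coprime (q i) (\<Prod>j\<in>E. q j)"
    using insert by (intro prod_coprime_right) auto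
  moreover have "q i dvd z" "(\<Prod>j\<in>E. q j) dvd z" using insert by auto
  ultimately show ?case using insert by (simp add: divides_mult)
qed simp

text \<open>Residues modulo pairwise coprime moduli form a code in which distinct words agree in few
  places, as the product of the moduli where \<open>x\<close> and \<open>y\<close> agree divides \<open>x - y\<close>.\<close>

lemma ex_residue_code:
  assumes "finite I"
  shows "\<exists>C. \<forall>t n. 1 \<le> t \<longrightarrow> n \<le> t ^ Suc h \<longrightarrow> (\<exists>w :: nat \<Rightarrow> 'i \<Rightarrow> nat.
    (\<forall>x. \<forall>i\<in>I. w x i \<le> C * t) \<and>
    (\<forall>x<n. \<forall>y<n. x \<noteq> y \<longrightarrow> card {i\<in>I. w x i = w y i} \<le> h))"
proof -
  obtain C where C: "\<And>t. 1 \<le> t \<Longrightarrow> \<exists>q :: 'i \<Rightarrow> nat.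
    (\<forall>i\<in>I. t < q i \<and> q i \<le> C * t) \<and> (\<forall>i\<in>I. \<forall>j\<in>I. i \<noteq> j \<longrightarrow> coprime (q i) (q j))"
    using ex_coprime_moduli[OF assms] by metis
  show ?thesis
  proof (intro exI[of _ C] allI impI)
    fix t n :: nat assume t: "1 \<le> t" and n: "n \<le> t ^ Suc h"
    obtain q :: "'i \<Rightarrow> nat" where q: "\<And>i. i \<in> I \<Longrightarrow> t < q i" "\<And>i. i \<in> I \<Longrightarrow> q i \<le> C * t"
      "\<And>i j. i \<in> I \<Longrightarrow> j \<in> I \<Longrightarrow> i \<noteq> j \<Longrightarrow> coprime (q i) (q j)"
      using C[OF t] by metis
    \<comment> \<open>More than \<open>h\<close> moduli, each above \<open>t\<close>, have product
      at least \<open>t ^ Suc h \<ge> n\<close>, too large to divide \<open>x - y\<close>, which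
      lies strictly between 0 and \<open>n\<close>.\<close>
    have few: "card {i\<in>I. x mod q i = y mod q i} \<le> h" if "x < n" "y < x" for x y
    proof (rule ccontr)
      let ?E = "{i\<in>I. x mod q i = y mod q i}"
      assume "\<not> card ?E \<le> h"
      then have "t ^ Suc h \<le> t ^ card ?E" using t by (intro power_increasing) auto
      also have "\<dots> = (\<Prod>i\<in>?E. t)" by simp
      also have "\<dots> \<le> (\<Prod>i\<in>?E. q i)" using q(1) by (intro prod_mono) (auto simp: less_imp_le)
      also have "\<dots> \<le> x - y"
      proof (rule dvd_imp_le)
        show "(\<Prod>i\<in>?E. q i) dvd x - y"
          using assms q(3) \<open>y < x\<close>
          by (intro prod_coprime_dvd) (auto simp: mod_eq_dvd_iff_nat)
      qed (use \<open>y < x\<close> in simp)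
      finally show False using n that by simp
    qed
    show "\<exists>w :: nat \<Rightarrow> 'i \<Rightarrow> nat. (\<forall>x. \<forall>i\<in>I. w x i \<le> C * t) \<and>
      (\<forall>x<n. \<forall>y<n. x \<noteq> y \<longrightarrow> card {i\<in>I. w x i = w y i} \<le> h)"
    proof (intro exI[of _ "\<lambda>x i. x mod q i"] conjI allI ballI impI)
      fix x i assume "i \<in> I"
      then have "x mod q i < q i" using q(1) by (intro mod_less_divisor) fastforce
      then show "x mod q i \<le> C * t" using q(2)[OF \<open>i \<in> I\<close>] by linarith
    next
      fix x y assume "x < n" "y < n" "x \<noteq> y"
      then consider "y < x" | "x < y" by linarith
      then show "card {i\<in>I. x mod q i = y mod q i} \<le> h"
      proof cases
        case 2
        then show ?thesis using few[OF \<open>y < n\<close>] by (simp add: eq_commute)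
      qed (use few \<open>x < n\<close> in simp)
    qed
  qed
qed

section \<open>Separating partitions from two codes\<close>

lemma ex_separating_partitions:
  "\<exists>C. \<forall>t n. 1 \<le> t \<longrightarrow> n \<le> t ^ Suc h \<longrightarrow> (\<exists>P Q :: nat \<Rightarrow> nat \<Rightarrow> nat \<Rightarrow> nat.
    (\<forall>x<n. \<forall>y<n. x \<noteq> y \<longrightarrow> (\<forall>z. P x y z \<le> C * t \<and> Q x y z \<le> C * t)) \<and>
    (\<forall>a<n. \<forall>b<n. \<forall>c<n. \<forall>d<n. a \<noteq> c \<longrightarrow> b \<noteq> d \<longrightarrow>
      P a c b \<noteq> P a c d \<or> Q b d a \<noteq> Q b d c))"
proof -
  \<comment> \<open>One place more than \<open>h\<close> sets of size \<open>h\<close> can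
    cover.\<close>
  define K where "K = {..h * h}"
  have finK: "finite K" by (simp add: K_def)
  obtain C1 where C1: "\<forall>t n. 1 \<le> t \<longrightarrow> n \<le> t ^ Suc h \<longrightarrow> (\<exists>v :: nat \<Rightarrow> nat \<Rightarrow> nat.
    (\<forall>x. \<forall>i\<in>K. v x i \<le> C1 * t) \<and> (\<forall>x<n. \<forall>y<n. x \<noteq> y \<longrightarrow> card {i\<in>K. v x i = v y i} \<le> h))"
    using ex_residue_code[OF finK, of h] by (rule exE)
  obtain C2 where C2: "\<forall>t n. 1 \<le> t \<longrightarrow> n \<le> t ^ Suc h \<longrightarrow> (\<exists>w :: nat \<Rightarrow> nat set \<Rightarrow> nat.
    (\<forall>x. \<forall>S\<in>Pow K. w x S \<le> C2 * t) \<and>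
    (\<forall>x<n. \<forall>y<n. x \<noteq> y \<longrightarrow> card {S\<in>Pow K. w x S = w y S} \<le> h))"
    using ex_residue_code[OF finite_Pow_iff[THEN iffD2, OF finK], of h] by (rule exE)
  show ?thesis
  proof (intro exI[of _ "max C1 C2"] allI impI)
    fix t n :: nat assume t: "1 \<le> t" and n: "n \<le> t ^ Suc h"
    obtain v :: "nat \<Rightarrow> nat \<Rightarrow> nat" where v: "\<And>x i. i \<in> K \<Longrightarrow> v x i \<le> C1 * t"
      "\<And>x y. x < n \<Longrightarrow> y < n \<Longrightarrow> x \<noteq> y \<Longrightarrow> card {i\<in>K. v x i = v y i} \<le> h"
      using C1[rule_format, OF t n] by blast
    obtain w :: "nat \<Rightarrow> nat set \<Rightarrow> nat" where w: "\<And>x S. S \<subseteq> K \<Longrightarrow> w x S \<le> C2 * t"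
      "\<And>x y. x < n \<Longrightarrow> y < n \<Longrightarrow> x \<noteq> y \<Longrightarrow> card {S\<in>Pow K. w x S = w y S} \<le> h"
      using C2[rule_format, OF t n] by blast
    define E where "E a c = {i\<in>K. v a i = v c i}" for a c
    \<comment> \<open>The size restriction keeps the union small; \<open>E a c\<close> meets it by
      the code property of \<open>v\<close>.\<close>
    define J where "J b d = {S. S \<subseteq> K \<and> card S \<le> h \<and> w b S = w d S}" for b d
    define i where "i b d = (SOME i. i \<in> K \<and> i \<notin> \<Union>(J b d))" for b d
    have i: "i b d \<in> K \<and> i b d \<notin> \<Union>(J b d)" if "b < n" "d < n" "b \<noteq> d" for b d
    proof -
      have JJ: "J b d \<subseteq> {S\<in>Pow K. w b S = w d S}" by (auto simp: J_def)
      have finJ: "finite (J b d)" using finite_subset[OF JJ] finK by simp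
      have "card (J b d) \<le> h" using card_mono[OF _ JJ] w(2)[OF that] finK by simp
      have "card (\<Union>(J b d)) \<le> sum card (J b d)"
        by (rule card_Union_le_sum_card)
      also have "\<dots> \<le> (\<Sum>S\<in>J b d. h)" by (intro sum_mono) (auto simp: J_def)
      also have "\<dots> \<le> h * h" using \<open>card (J b d) \<le> h\<close> by simp
      also have "\<dots> < card K" by (simp add: K_def)
      finally have "\<not> K \<subseteq> \<Union>(J b d)"
        using card_mono[of "\<Union>(J b d)" K] finJ finK
        by (metis (no_types, lifting) J_def finite_Union finite_subset mem_Collect_eq not_less)
      then have "\<exists>i. i \<in> K \<and> i \<notin> \<Union>(J b d)" by blast
      then show ?thesis unfolding i_def by (rule someI_ex)
    qed
    have bound: "k \<le> max C1 C2 * t" if "k \<le> C1 * t \<or> k \<le> C2 * t" for k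
      using that by (metis le_trans max.cobounded1 max.cobounded2 mult_le_mono1)
    show "\<exists>P Q :: nat \<Rightarrow> nat \<Rightarrow> nat \<Rightarrow> nat.
      (\<forall>x<n. \<forall>y<n. x \<noteq> y \<longrightarrow> (\<forall>z. P x y z \<le> max C1 C2 * t \<and> Q x y z \<le> max C1 C2 * t)) \<and>
      (\<forall>a<n. \<forall>b<n. \<forall>c<n. \<forall>d<n. a \<noteq> c \<longrightarrow> b \<noteq> d \<longrightarrow>
        P a c b \<noteq> P a c d \<or> Q b d a \<noteq> Q b d c)"
    proof (rule exI[of _ "\<lambda>a c b. w b (E a c)"], rule exI[of _ "\<lambda>b d a. v a (i b d)"],
        intro conjI allI impI)
      fix x y z assume xy: "x < n" "y < n" "x \<noteq> y"
      show "w z (E x y) \<le> max C1 C2 * t" by (intro bound disjI2 w(1)) (auto simp: E_def)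
      show "v z (i x y) \<le> max C1 C2 * t" using i[OF xy] by (intro bound disjI1 v(1)) auto
    next
      fix a b c d assume lt: "a < n" "b < n" "c < n" "d < n" and ne: "a \<noteq> c" "b \<noteq> d"
      show "w b (E a c) \<noteq> w d (E a c) \<or> v a (i b d) \<noteq> v c (i b d)"
      proof (rule ccontr)
        assume "\<not> ?thesis"
        then have *: "w b (E a c) = w d (E a c)" "v a (i b d) = v c (i b d)" by auto
        have "E a c \<in> J b d" using * v(2)[of a c] lt ne by (auto simp: J_def E_def)
        moreover have "i b d \<in> E a c" using * i[of b d] lt ne by (auto simp: E_def)
        ultimately show False using i[of b d] lt ne by blast
      qed
    qed
  qed
qed

section \<open>Levels of edges and the colouring\<close>

text \<open>For an edge, one more than the position of the highest binary digit in which its ends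
  differ.\<close>

definition level :: "nat set \<Rightarrow> nat" where
  "level e = (LEAST l. Min e div 2 ^ l = Max e div 2 ^ l)"

lemma level_le:
  assumes "finite e" "e \<noteq> {}" "\<And>x. x \<in> e \<Longrightarrow> x < 2 ^ L"
  shows "level e \<le> L"
  unfolding level_def using assms by (intro Least_le) (metis Max_in Min_in div_less)

text \<open>Dropping one digit fewer than the level leaves distinct numbers with equal halves: an
  even number and its successor.\<close>

lemma level_parity:
  assumes "x < y"
  shows "even (x div 2 ^ (level {x, y} - 1))" "odd (y div 2 ^ (level {x, y} - 1))"
proof -
  define l where "l = level {x, y}"
  have l_eq: "l = (LEAST l. x div 2 ^ l = y div 2 ^ l)"
    using assms by (simp add: l_def level_def min_def max_def)
  \<comment> \<open>Both quotients are 0, so the \<open>LEAST\<close> is over a nonempty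
    set.\<close>
  have "x div 2 ^ y = y div 2 ^ y"
    using assms less_exp[of y] by (metis div_less less_trans)
  then have eq: "x div 2 ^ l = y div 2 ^ l" unfolding l_eq by (rule LeastI)
  then obtain k where k: "l = Suc k" using assms by (cases l) auto
  have "x div 2 ^ k \<noteq> y div 2 ^ k"
    using not_less_Least[of k "\<lambda>l. x div 2 ^ l = y div 2 ^ l"] k l_eq by simp
  moreover have "x div 2 ^ k \<le> y div 2 ^ k" using assms by (intro div_le_mono) simp
  moreover have "x div 2 ^ k div 2 = y div 2 ^ k div 2"
    using eq k by (simp add: div_mult2_eq[symmetric] mult.commute)
  moreover have "even m \<and> odd m'" if "m \<noteq> m'" "m \<le> m'" "m div 2 = m' div 2" for m m' :: nat
    using that by presburger
  ultimately have "even (x div 2 ^ k) \<and> odd (y div 2 ^ k)" by blast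
  then show "even (x div 2 ^ (level {x, y} - 1))" "odd (y div 2 ^ (level {x, y} - 1))"
    using k l_def by auto
qed

lemma level_parity_iff:
  assumes "x \<noteq> y"
  shows "odd (x div 2 ^ (level {x, y} - 1)) \<longleftrightarrow> y < x"
    "odd (y div 2 ^ (level {x, y} - 1)) \<longleftrightarrow> x < y"
  using level_parity[of x y] level_parity[of y x] assms
  by (metis insert_commute linorder_neqE_nat order_less_asym)+

text \<open>The vertices that share their binary digits from position \<open>level e\<close> on with those of \<open>e\<close> split
  by the digit at position \<open>level e - 1\<close> into two sides, with \<open>Min e\<close> and \<open>Max e\<close> on different
  sides; \<open>P\<close> is used for \<open>u\<close> on the side of \<open>Min e\<close> and \<open>Q\<close> on the other.\<close>

definition path_colouring ::
    "(nat \<Rightarrow> nat \<Rightarrow> nat \<Rightarrow> nat) \<Rightarrow> (nat \<Rightarrow> nat \<Rightarrow> nat \<Rightarrow> nat) \<Rightarrow> nat \<Rightarrow> nat set \<Rightarrow> nat" where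
  "path_colouring P Q u e =
    (if u \<in> e then 2 * level e
     else if odd (u div 2 ^ (level e - 1)) then 2 * Q u (Max e) (Min e) + 1
     else 2 * P u (Min e) (Max e) + 1)"

text \<open>The parity of a colour tells whether \<open>u\<close> lies on the edge, and on edges
  through \<open>u\<close> the colour encodes the level.\<close>

lemma path_colouring_neq:
  assumes "(u \<in> e) \<noteq> (u \<in> e') \<or> u \<in> e \<and> u \<in> e' \<and> level e \<noteq> level e'"
  shows "path_colouring P Q u e \<noteq> path_colouring P Q u e'"
proof -
  have "even (path_colouring P Q u e) \<longleftrightarrow> u \<in> e" for e by (simp add: path_colouring_def)
  then show ?thesis using assms by (metis path_colouring_def mult_cancel1 zero_neq_numeral)
qed

text \<open>If neither \<open>b\<close> nor \<open>c\<close> works, then the three edges have the same level \<open>l\<close>, so the bits of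
  \<open>a, b, c, d\<close> at position \<open>l - 1\<close> alternate.\<close>

lemma path_colouring_rainbow:
  fixes a b c d :: nat
  assumes dist: "distinct [a, b, c, d]" and lt: "a < n" "b < n" "c < n" "d < n"
    and sep: "\<forall>a<n. \<forall>b<n. \<forall>c<n. \<forall>d<n. a \<noteq> c \<longrightarrow> b \<noteq> d \<longrightarrow>
      P a c b \<noteq> P a c d \<or> Q b d a \<noteq> Q b d c"
  shows "\<exists>u\<in>{a, b, c, d}. inj_on (path_colouring P Q u) {{a, b}, {b, c}, {c, d}}"
proof (rule ccontr)
  let ?f = "path_colouring P Q"
  assume contr: "\<not> ?thesis"
  have inj: "inj_on (?f u) {{a, b}, {b, c}, {c, d}}"
    if "?f u {a, b} \<noteq> ?f u {b, c}" "?f u {b, c} \<noteq> ?f u {c, d}" "?f u {a, b} \<noteq> ?f u {c, d}" for u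
    using that by (auto simp: inj_on_def)
  \<comment> \<open>The edge \<open>{c, d}\<close> misses \<open>b\<close>, so different levels on
    the two edges through \<open>b\<close> would make \<open>b\<close> work.\<close>
  have "level {a, b} = level {b, c}"
  proof (rule ccontr)
    assume "level {a, b} \<noteq> level {b, c}"
    then have "inj_on (?f b) {{a, b}, {b, c}, {c, d}}"
      using dist by (intro inj) (simp_all add: path_colouring_neq)
    then show False using contr by blast
  qed
  moreover have "level {b, c} = level {c, d}"
  proof (rule ccontr)
    assume "level {b, c} \<noteq> level {c, d}"
    then have "inj_on (?f c) {{a, b}, {b, c}, {c, d}}"
      using dist by (intro inj) (simp_all add: path_colouring_neq)
    then show False using contr by blast
  qed
  moreover define l where "l = level {b, c}"
  ultimately have l: "level {a, b} = l" "level {b, c} = l" "level {c, d} = l" by auto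
  define s where "s x = odd (x div 2 ^ (l - 1))" for x :: nat
  have s: "s a \<longleftrightarrow> b < a" "s b \<longleftrightarrow> a < b" "s b \<longleftrightarrow> c < b" "s c \<longleftrightarrow> b < c" "s c \<longleftrightarrow> d < c" "s d \<longleftrightarrow> c < d"
    using level_parity_iff[of a b] level_parity_iff[of b c] level_parity_iff[of c d] dist
    by (auto simp: l s_def)
  \<comment> \<open>Only \<open>{a, b}\<close> contains \<open>a\<close>, so \<open>a\<close> can
    fail only by a clash between the other two edges.\<close>
  have fa: "?f a {b, c} = ?f a {c, d}"
  proof (rule ccontr)
    assume "?f a {b, c} \<noteq> ?f a {c, d}"
    then have "inj_on (?f a) {{a, b}, {b, c}, {c, d}}"
      using dist by (intro inj) (simp_all add: path_colouring_neq)
    then show False using contr by blast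
  qed
  have fd: "?f d {a, b} = ?f d {b, c}"
  proof (rule ccontr)
    assume "?f d {a, b} \<noteq> ?f d {b, c}"
    then have "inj_on (?f d) {{a, b}, {b, c}, {c, d}}"
      using dist by (intro inj) (simp_all add: path_colouring_neq)
    then show False using contr by blast
  qed
  show False
  proof (cases "s a")
    case False
    then have "a < b" "c < b" "c < d" "s d" using s dist by auto
    then have "P a c b = P a c d" "Q d b a = Q d b c"
      using fa fd False dist by (auto simp: path_colouring_def l s_def min_def max_def)
    then show False using sep[rule_format, of a d c b] lt dist by auto
  \<comment> \<open>The other orientation is the same argument for the path read from
    \<open>d\<close> to \<open>a\<close>.\<close>
  next
    case True
    then have "b < a" "b < c" "d < c" "\<not> s d" using s dist by auto
    then have "Q a c b = Q a c d" "P d b a = P d b c"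
      using fa fd True dist by (auto simp: path_colouring_def l s_def min_def max_def)
    then show False using sep[rule_format, of d a b c] lt dist by auto
  qed
qed

section \<open>Copies of the path and the bound on \<open>g\<close>\<close>

lemma copies_path_graph_3E:
  assumes "T \<in> copies n (path_graph 3)"
  obtains a b c d where "distinct [a, b, c, d]" "vertices T = {a, b, c, d}"
    "edges T \<subseteq> {{a, b}, {b, c}, {c, d}}" "{a, b, c, d} \<subseteq> {..<n}"
proof -
  from assms have simple: "edges T \<subseteq> {e. e \<subseteq> vertices T \<and> card e = 2}"
    and V: "vertices T \<subseteq> {..<n}" and iso: "isomorphic T (path_graph 3)"
    by (auto simp: copies_def is_subgraph_def simple_graph_def complete_graph_def)
  obtain \<phi> where bij: "bij_betw \<phi> (vertices T) {..3}" and
    \<phi>: "\<And>u v. u \<in> vertices T \<Longrightarrow> v \<in> vertices T \<Longrightarrow>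
      {u, v} \<in> edges T \<longleftrightarrow> {\<phi> u, \<phi> v} \<in> {{i, Suc i} | i. i < 3}"
    using iso unfolding isomorphic_def path_graph_def by auto
  define \<psi> where "\<psi> = inv_into (vertices T) \<phi>"
  have bij': "bij_betw \<psi> {..3} (vertices T)" unfolding \<psi>_def by (rule bij_betw_inv_into[OF bij])
  have \<psi>\<phi>: "\<psi> (\<phi> u) = u" if "u \<in> vertices T" for u
    unfolding \<psi>_def using bij_betw_inv_into_left[OF bij that] .
  have at: "{..3::nat} = {0, 1, 2, 3}" by auto
  have VT: "vertices T = {\<psi> 0, \<psi> 1, \<psi> 2, \<psi> 3}"
    using bij_betw_imp_surj_on[OF bij'] unfolding at by auto
  have "distinct [\<psi> 0, \<psi> 1, \<psi> 2, \<psi> 3]"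
    using bij_betw_imp_inj_on[OF bij'] unfolding at by (auto simp: inj_on_def)
  moreover have "edges T \<subseteq> {{\<psi> 0, \<psi> 1}, {\<psi> 1, \<psi> 2}, {\<psi> 2, \<psi> 3}}"
  proof
    fix e assume e: "e \<in> edges T"
    then obtain u v where uv: "e = {u, v}" "u \<in> vertices T" "v \<in> vertices T"
      using simple by (auto simp: card_2_iff)
    then obtain i where i: "{\<phi> u, \<phi> v} = {i, Suc i}" "i < 3" using e \<phi>[of u v] by auto
    have "e = \<psi> ` {\<phi> u, \<phi> v}" using uv \<psi>\<phi> by auto
    then have "e = {\<psi> i, \<psi> (Suc i)}" using i by simp
    moreover have "i = 0 \<or> i = 1 \<or> i = 2" using i(2) by auto
    ultimately show "e \<in> {{\<psi> 0, \<psi> 1}, {\<psi> 1, \<psi> 2}, {\<psi> 2, \<psi> 3}}"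
      by (auto simp: numeral_2_eq_2 numeral_3_eq_3)
  qed
  ultimately show ?thesis using that VT V by metis
qed

text \<open>The integer \<open>t\<close> stands for the root of \<open>n\<close> of order
  \<open>Suc h\<close>; \<open>C\<close> depends on \<open>h\<close> alone.\<close>

lemma g_path_le_linear_root:
  "\<exists>C. \<forall>t n. 1 \<le> t \<longrightarrow> n \<le> t ^ Suc h \<longrightarrow> g n (path_graph 3) \<le> C * t"
proof -
  obtain C where C: "\<forall>t n. 1 \<le> t \<longrightarrow> n \<le> t ^ Suc h \<longrightarrow> (\<exists>P Q :: nat \<Rightarrow> nat \<Rightarrow> nat \<Rightarrow> nat.
    (\<forall>x<n. \<forall>y<n. x \<noteq> y \<longrightarrow> (\<forall>z. P x y z \<le> C * t \<and> Q x y z \<le> C * t)) \<and>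
    (\<forall>a<n. \<forall>b<n. \<forall>c<n. \<forall>d<n. a \<noteq> c \<longrightarrow> b \<noteq> d \<longrightarrow>
      P a c b \<noteq> P a c d \<or> Q b d a \<noteq> Q b d c))"
    using ex_separating_partitions[of h] by (rule exE)
  show ?thesis
  \<comment> \<open>Levels and values of \<open>P\<close>, \<open>Q\<close> are at most
    \<open>B = (C + Suc h) * t\<close>, so the colours lie in \<open>{..2 * B + 1}\<close>.\<close>
  proof (intro exI[of _ "2 * (C + Suc h) + 2"] allI impI)
    fix t n :: nat assume t: "1 \<le> t" and n: "n \<le> t ^ Suc h"
    obtain P Q :: "nat \<Rightarrow> nat \<Rightarrow> nat \<Rightarrow> nat" where
      le: "\<forall>x<n. \<forall>y<n. x \<noteq> y \<longrightarrow> (\<forall>z. P x y z \<le> C * t \<and> Q x y z \<le> C * t)" and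
      sep: "\<forall>a<n. \<forall>b<n. \<forall>c<n. \<forall>d<n. a \<noteq> c \<longrightarrow> b \<noteq> d \<longrightarrow>
        P a c b \<noteq> P a c d \<or> Q b d a \<noteq> Q b d c"
      using C[THEN spec, THEN spec, THEN mp, THEN mp, OF t n] by (elim exE conjE) (rule that)
    let ?f = "path_colouring P Q"
    have "local_collection n (path_graph 3) ?f"
      unfolding local_collection_def
    proof
      fix T assume "T \<in> copies n (path_graph 3)"
      then obtain a b c d where T: "distinct [a, b, c, d]" "vertices T = {a, b, c, d}"
        "edges T \<subseteq> {{a, b}, {b, c}, {c, d}}" "{a, b, c, d} \<subseteq> {..<n}"
        by (rule copies_path_graph_3E)
      have "\<exists>u\<in>{a, b, c, d}. inj_on (?f u) {{a, b}, {b, c}, {c, d}}"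
        using T(4) by (intro path_colouring_rainbow[OF T(1) _ _ _ _ sep]) auto
      then obtain u where "u \<in> vertices T" "inj_on (?f u) {{a, b}, {b, c}, {c, d}}"
        unfolding T(2) by (rule bexE)
      then show "\<exists>u\<in>vertices T. inj_on (?f u) (edges T)"
        using inj_on_subset[OF _ T(3)] by (intro bexI)
    qed
    moreover have "uses_at_most n ?f ((2 * (C + Suc h) + 2) * t)"
      unfolding uses_at_most_def
    proof
      fix u assume "u \<in> vertices (complete_graph n)"
      then have u: "u < n" by (simp add: complete_graph_def)
      define B where "B = (C + Suc h) * t"
      have "?f u e \<le> 2 * B + 1" if "e \<in> edges (complete_graph n)" for e
      proof -
        have e: "e \<subseteq> {..<n}" "card e = 2" using that by (auto simp: complete_graph_def)
        then have fin: "finite e" "e \<noteq> {}" by (auto intro: card_ge_0_finite)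
        then have mem: "Min e \<in> e" "Max e \<in> e" by auto
        \<comment> \<open>The crude bound \<open>t < 2 ^ t\<close> already makes the number of
          levels linear in \<open>t\<close>.\<close>
        have "t ^ Suc h \<le> (2 ^ t) ^ Suc h"
          using less_exp[of t] by (intro power_mono) auto
        then have "n \<le> 2 ^ (t * Suc h)" using n by (simp only: power_mult)
        then have "level e \<le> t * Suc h"
          using e(1) fin by (intro level_le) fastforce+
        then have "level e \<le> B" by (simp add: B_def algebra_simps)
        \<comment> \<open>The bounds on \<open>P\<close> and \<open>Q\<close> hold for distinct
          first arguments, which \<open>u \<notin> e\<close> provides.\<close>
        moreover have "P u (Min e) (Max e) \<le> B" "Q u (Max e) (Min e) \<le> B" if "u \<notin> e"
        proof -
          have "P u (Min e) (Max e) \<le> C * t" "Q u (Max e) (Min e) \<le> C * t"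
            using le[rule_format, of u "Min e" "Max e"] le[rule_format, of u "Max e" "Min e"]
              u mem e(1) that by blast+
          then show "P u (Min e) (Max e) \<le> B" "Q u (Max e) (Min e) \<le> B"
            by (simp_all add: B_def algebra_simps)
        qed
        ultimately show ?thesis by (auto simp: path_colouring_def)
      qed
      then have "?f u ` edges (complete_graph n) \<subseteq> {..2 * B + 1}" by auto
      then have "card (?f u ` edges (complete_graph n)) \<le> card {..2 * B + 1}"
        by (intro card_mono) auto
      also have "\<dots> = 2 * B + 2" by simp
      also have "\<dots> \<le> (2 * (C + Suc h) + 2) * t" using t by (simp add: B_def algebra_simps)
      finally show "card (?f u ` edges (complete_graph n)) \<le> (2 * (C + Suc h) + 2) * t" .
    qed
    ultimately show "g n (path_graph 3) \<le> (2 * (C + Suc h) + 2) * t"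
      unfolding g_def by (intro Least_le) blast
  qed
qed

section \<open>Passage to real exponents and the limit\<close>

lemma g_path_le_powr:
  "\<exists>C>0. \<forall>n\<ge>1. real (g n (path_graph 3)) \<le> C * real n powr (1 / Suc h)"
proof -
  obtain C where C: "\<And>t n. 1 \<le> t \<Longrightarrow> n \<le> t ^ Suc h \<Longrightarrow> g n (path_graph 3) \<le> C * t"
    using g_path_le_linear_root by metis
  show ?thesis
  \<comment> \<open>Rounding a root \<open>r \<ge> 1\<close> up to an integer at most doubles it;
    the summand 1 makes the constant positive.\<close>
  proof (intro exI[of _ "2 * real C + 1"] conjI allI impI)
    fix n :: nat assume n: "1 \<le> n"
    define r where "r = real n powr (1 / Suc h)"
    have r: "1 \<le> r" unfolding r_def using n by (intro ge_one_powr_ge_zero) auto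
    have "real n = r ^ Suc h"
      unfolding r_def using n by (subst powr_realpow[symmetric]) (auto simp: powr_powr)
    define t where "t = nat \<lceil>r\<rceil>"
    have t: "r \<le> real t" "real t \<le> 2 * r" "1 \<le> t"
      unfolding t_def using r by linarith+
    have "real n \<le> real t ^ Suc h"
      unfolding \<open>real n = r ^ Suc h\<close> using t r by (intro power_mono) auto
    then have "n \<le> t ^ Suc h" by (metis of_nat_le_iff of_nat_power)
    then have "real (g n (path_graph 3)) \<le> real (C * t)" using C[OF t(3)] by (intro of_nat_mono)
    also have "\<dots> \<le> real C * (2 * r)" using t by (simp add: mult_left_mono)
    also have "\<dots> \<le> (2 * real C + 1) * r" using r by (simp add: algebra_simps)
    finally show "real (g n (path_graph 3)) \<le> (2 * real C + 1) * real n powr (1 / Suc h)"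
      unfolding r_def .
  qed auto
qed

text \<open>There is an edge to colour. This makes \<open>ln\<close> of \<open>g\<close>
  nonnegative, so the exponent needs only an upper bound.\<close>

lemma g_path_pos:
  assumes "2 \<le> n"
  shows "1 \<le> g n (path_graph 3)"
proof -
  have "vertices (path_graph 3) \<noteq> {}" by (simp add: path_graph_def)
  from g_attained[OF this] obtain f where "uses_at_most n f (g n (path_graph 3))" by blast
  then have le: "card (f 0 ` edges (complete_graph n)) \<le> g n (path_graph 3)"
    using assms by (auto simp: uses_at_most_def complete_graph_def)
  have "{0, 1} \<in> edges (complete_graph n)" using assms by (auto simp: complete_graph_def)
  moreover have "finite (edges (complete_graph n))" by (simp add: complete_graph_def)
  ultimately have "0 < card (f 0 ` edges (complete_graph n))" by (auto simp: card_gt_0_iff)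
  then show ?thesis using le by linarith
qed

theorem theorem1p7:
  shows "\<exists>\<epsilon> :: nat \<Rightarrow> real. \<epsilon> \<in> o(\<lambda>_. 1) \<and>
           (\<forall>\<^sub>F n in at_top. real (g n (path_graph 3)) = real n powr \<epsilon> n)"
proof (intro exI conjI)
  let ?g = "\<lambda>n. real (g n (path_graph 3))"
  let ?\<epsilon> = "\<lambda>n. ln (?g n) / ln (real n)"
  show "\<forall>\<^sub>F n in at_top. ?g n = real n powr ?\<epsilon> n"
    using eventually_ge_at_top[of 2]
  proof eventually_elim
    case (elim n)
    then have "0 < ?g n" using g_path_pos[of n] by linarith
    then show ?case using elim by (simp add: powr_def)
  qed
  have "(?\<epsilon> \<longlongrightarrow> 0) at_top"
  proof (rule LIMSEQ_I)
    fix e :: real assume e: "0 < e"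
    \<comment> \<open>Half of \<open>e\<close> pays for the exponent; with \<open>h\<close> and
      hence \<open>C\<close> fixed, the other half pays for \<open>ln C / ln n\<close>.\<close>
    obtain h :: nat where h: "1 / Suc h < e / 2" using e nat_approx_posE[of "e / 2"] by auto
    obtain C where C: "0 < C" "\<And>n. 1 \<le> n \<Longrightarrow> ?g n \<le> C * real n powr (1 / Suc h)"
      using g_path_le_powr[of h] by metis
    have "((\<lambda>n. ln C / ln (real n)) \<longlongrightarrow> 0) at_top"
      by (intro tendsto_divide_0[OF tendsto_const] filterlim_at_top_imp_at_infinity
          filterlim_compose[OF ln_at_top filterlim_real_sequentially])
    then have "\<forall>\<^sub>F n in at_top. ln C / ln (real n) < e / 2" using e by (intro order_tendstoD) auto
    then have "\<forall>\<^sub>F n in at_top. norm (?\<epsilon> n - 0) < e"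
      using eventually_ge_at_top[of 2]
    proof eventually_elim
      case (elim n)
      then have g: "1 \<le> ?g n" using g_path_pos[of n] by simp
      have ln: "0 < ln (real n)" using elim by simp
      have "ln (?g n) \<le> ln (C * real n powr (1 / Suc h))"
        using C(2)[of n] g elim by simp
      also have "\<dots> = ln C + ln (real n) / Suc h" using C(1) elim by (simp add: ln_mult ln_powr)
      finally have "?\<epsilon> n \<le> (ln C + ln (real n) / Suc h) / ln (real n)"
        using ln by (intro divide_right_mono) auto
      also have "\<dots> = ln C / ln (real n) + 1 / Suc h" using ln by (simp add: add_divide_distrib)
      finally have "?\<epsilon> n < e" using h elim by linarith
      moreover have "0 \<le> ?\<epsilon> n" using g ln by simp
      ultimately show ?case by simp
    qed
    then show "\<exists>no. \<forall>n\<ge>no. norm (?\<epsilon> n - 0) < e" by (simp add: eventually_sequentially)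
  qed
  then show "?\<epsilon> \<in> o(\<lambda>_. 1)" by (intro smalloI_tendsto) simp_all
qed

end
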